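(* For every $\varepsilon=(\varepsilon_i)_{i\in I}$ with $\varepsilon_i>0$ for all $i\in I$, the duality gap of the modified problem is nonnegative and not higher than the duality gap of the original problem: $$0\le\tilde\nu(\varepsilon)-\tilde\nu^D(\varepsilon)\le\nu-\nu^D.$$
   Context: Market data: $I=\{1,\dots,|I|\}$ is a finite nonempty set of generating units; for each $i\in I$: $g_i^{\max}>0$, $w_i\ge 0$, and $c_i:[0,g_i^{\max}]\to\mathbb{R}$ is a non-decreasing convex continuous function with $c_i(0)=0$. The demand $d$ is a fixed real number with $0\le d\le\sum_{i\in I}g_i^{\max}$. For $x_i=(u_i,g_i)$ the cost is $C_i(x_i)=c_i(g_i)+w_iu_i$, and the private feasible set is $X_i=\{(u_i,g_i): u_i\in\{0,1\},\ g_i\in\mathbb{R},\ 0\le g_i\le u_ig_i^{\max}\}$. Let $\Omega=\{x=(x_i)_{i\in I}: x_i\in X_i\ \forall i\in I,\ \sum_{i\in I}g_i=d\}$. Original primal and dual problems: $\nu=\min_{x\in\Omega}\sum_{i\in I}C_i(x_i)$ and $\nu^D=\max_{p\in\mathbb{R}}[pd-\sum_{i\in I}\pi_i(p)]$, where $\pi_i(p)=\max_{x_i\in X_i}[pg_i-C_i(x_i)]$. Attainable schedules: $\overline{\Omega}$ is the set of all $\bar x=(\bar x_i)_{i\in I}$, $\bar x_i=(\bar u_i,\bar g_i)$ with $\bar u_i\in\{0,1\}$, $0\le\bar g_i\le g_i^{\max}$, such that $\bar x$ is a minimizer of $\sum_{i\in I}C_i(x_i)$ over all $x\in\Omega$ with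 $u_i\le\bar u_i$, $g_i\le\bar g_i$ for all $i\in I$ (in particular $\bar x\in\Omega$). $\overline{\Omega}_i\subset X_i$ denotes the projection of $\overline{\Omega}$ onto the $i$-th component. Modified private feasible sets: for $\varepsilon_i>0$, $$\tilde X_i(\varepsilon_i)=\{(0,0)\}\cup\bigcup_{\bar x_i\in\overline{\Omega}_i}\{(u_i,g_i)\in X_i: |g_i-\bar g_i|\le\varepsilon_i\}.$$ Modified primal and dual problems: $\tilde\nu(\varepsilon)=\min\{\sum_{i\in I}C_i(x_i): x_i\in\tilde X_i(\varepsilon_i)\ \forall i\in I,\ \sum_{i\in I}g_i=d\}$ and $\tilde\nu^D(\varepsilon)=\max_{p\in\mathbb{R}}[pd-\sum_{i\in I}\tilde\pi_i(p,\varepsilon_i)]$, where $\tilde\pi_i(p,\varepsilon_i)=\max_{x_i\in\tilde X_i(\varepsilon_i)}[pg_i-C_i(x_i)]$. *)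

theory Defs
  imports "HOL-Analysis.Analysis"
begin

text \<open>
  A decision of a single generating unit is a pair \<open>(u, g)\<close> of a commitment variable
  \<open>u \<in> {0, 1}\<close> and an output \<open>g\<close>, both encoded as reals. A schedule is an extensional
  family of such pairs over the index set of the units.
\<close>

definition unit_cost :: "(real \<Rightarrow> real) \<Rightarrow> real \<Rightarrow> real \<times> real \<Rightarrow> real" where
  "unit_cost c w = (\<lambda>(u, g). c g + w * u)"

definition unit_feasible :: "real \<Rightarrow> (real \<times> real) set" where
  "unit_feasible gmax = {(u, g). u \<in> {0, 1} \<and> 0 \<le> g \<and> g \<le> u * gmax}"

definition total_cost ::
    "'i set \<Rightarrow> ('i \<Rightarrow> real \<times> real \<Rightarrow> real) \<Rightarrow> ('i \<Rightarrow> real \<times> real) \<Rightarrow> real" where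
  "total_cost I C x = (\<Sum>i\<in>I. C i (x i))"

definition schedules ::
    "'i set \<Rightarrow> real \<Rightarrow> ('i \<Rightarrow> (real \<times> real) set) \<Rightarrow> ('i \<Rightarrow> real \<times> real) set" where
  "schedules I d Y = {x \<in> Pi\<^sub>E I Y. (\<Sum>i\<in>I. snd (x i)) = d}"

text \<open>
  The primal and dual values depend on the private feasible sets \<open>Y i\<close>, so that the
  original and the modified problem are two instances of the same definitions.
  Minima and maxima are rendered as \<open>Inf\<close> and \<open>Sup\<close> of sets of reals. Under the standing
  assumptions on the market all these sets are nonempty and bounded on the relevant side.
  The supremum over the prices need not be attained: this happens for \<open>d = (\<Sum>i\<in>I. gmax i)\<close>
  when some \<open>c i\<close> has infinite slope at \<open>gmax i\<close>.
\<close>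

definition primal_value ::
    "'i set \<Rightarrow> real \<Rightarrow> ('i \<Rightarrow> real \<times> real \<Rightarrow> real) \<Rightarrow> ('i \<Rightarrow> (real \<times> real) set) \<Rightarrow> real" where
  "primal_value I d C Y = (INF x \<in> schedules I d Y. total_cost I C x)"

definition unit_profit :: "(real \<times> real \<Rightarrow> real) \<Rightarrow> (real \<times> real) set \<Rightarrow> real \<Rightarrow> real" where
  "unit_profit Ci Yi p = (SUP x \<in> Yi. p * snd x - Ci x)"

definition dual_value ::
    "'i set \<Rightarrow> real \<Rightarrow> ('i \<Rightarrow> real \<times> real \<Rightarrow> real) \<Rightarrow> ('i \<Rightarrow> (real \<times> real) set) \<Rightarrow> real" where
  "dual_value I d C Y = (SUP p. p * d - (\<Sum>i\<in>I. unit_profit (C i) (Y i) p))"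

definition attainable_schedules ::
    "'i set \<Rightarrow> real \<Rightarrow> ('i \<Rightarrow> real) \<Rightarrow> ('i \<Rightarrow> real \<times> real \<Rightarrow> real) \<Rightarrow> ('i \<Rightarrow> real \<times> real) set" where
  "attainable_schedules I d gmax C =
    {xb \<in> (\<Pi>\<^sub>E i\<in>I. {0, 1} \<times> {0..gmax i}).
      is_arg_min (total_cost I C)
        (\<lambda>x. x \<in> schedules I d (\<lambda>i. unit_feasible (gmax i)) \<and>
             (\<forall>i\<in>I. fst (x i) \<le> fst (xb i) \<and> snd (x i) \<le> snd (xb i))) xb}"

definition modified_feasible ::
    "'i set \<Rightarrow> real \<Rightarrow> ('i \<Rightarrow> real) \<Rightarrow> ('i \<Rightarrow> real \<times> real \<Rightarrow> real) \<Rightarrow> 'i \<Rightarrow> real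
      \<Rightarrow> (real \<times> real) set" where
  "modified_feasible I d gmax C i e =
    {(0, 0)} \<union>
    (\<Union>(ub, gb) \<in> (\<lambda>x. x i) ` attainable_schedules I d gmax C.
       {(u, g) \<in> unit_feasible (gmax i). \<bar>g - gb\<bar> \<le> e})"

end

theory Submission
  imports Defs
begin

text \<open>
  Shrinking the private feasible sets without losing a single optimal schedule can only
  close the duality gap. The primal value is unchanged, because it is still attained by the
  surviving optimal schedule and no cheaper one has been added; each unit's profit is a
  supremum over a smaller set and hence decreases, so the dual value increases. Weak duality
  keeps the new gap nonnegative. This is \<open>duality_gap_mono\<close>, which holds for arbitrary costs
  and feasible sets with finite profits.

  The modified sets fit this pattern: a cost-minimal schedule exists by compactness
  (\<open>optimal_schedule_exists\<close>), and it remains minimal among the schedules that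
  lie below it. It is therefore attainable, and each of its components is the centre of one of
  the windows that make up the modified feasible set (\<open>optimal_schedule_modified_feasible\<close>).
\<close>

section \<open>Duality gaps under restriction of the feasible sets\<close>

lemma weak_duality:
  assumes "x \<in> schedules I d Y"
    and bdd: "\<And>i. i \<in> I \<Longrightarrow> bdd_above ((\<lambda>y. p * snd y - C i y) ` Y i)"
  shows "p * d - (\<Sum>i\<in>I. unit_profit (C i) (Y i) p) \<le> total_cost I C x"
proof -
  have x: "\<And>i. i \<in> I \<Longrightarrow> x i \<in> Y i" and d: "(\<Sum>i\<in>I. snd (x i)) = d"
    using assms(1) by (auto simp: schedules_def)
  have "p * d - total_cost I C x = (\<Sum>i\<in>I. p * snd (x i) - C i (x i))"
    by (simp add: total_cost_def sum_subtractf d flip: sum_distrib_left)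
  also have "\<dots> \<le> (\<Sum>i\<in>I. unit_profit (C i) (Y i) p)"
    unfolding unit_profit_def using x bdd by (intro sum_mono cSUP_upper)
  finally show ?thesis by simp
qed

lemma primal_value_eq_optimal_cost:
  assumes "x \<in> schedules I d Y"
    and "\<And>y. y \<in> schedules I d Y \<Longrightarrow> total_cost I C x \<le> total_cost I C y"
  shows "primal_value I d C Y = total_cost I C x"
  unfolding primal_value_def using assms by (intro cInf_eq_minimum) auto

text \<open>
  Besides giving the monotonicity of the profits, the bound on them enters through weak
  duality: it makes the suprema over the prices finite, so that they can be compared.
\<close>

lemma duality_gap_mono:
  assumes sub: "\<And>i. i \<in> I \<Longrightarrow> Y' i \<subseteq> Y i"
    and bdd: "\<And>i p. i \<in> I \<Longrightarrow> bdd_above ((\<lambda>y. p * snd y - C i y) ` Y i)"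
    and x: "x \<in> schedules I d Y'"
    and opt: "\<And>y. y \<in> schedules I d Y \<Longrightarrow> total_cost I C x \<le> total_cost I C y"
  shows "0 \<le> primal_value I d C Y' - dual_value I d C Y'"
    and "primal_value I d C Y' - dual_value I d C Y'
           \<le> primal_value I d C Y - dual_value I d C Y"
proof -
  have sched: "schedules I d Y' \<subseteq> schedules I d Y"
    using sub by (fastforce simp: schedules_def PiE_iff)
  have bdd': "bdd_above ((\<lambda>y. p * snd y - C i y) ` Y' i)" if "i \<in> I" for i p
    using bdd[OF that] sub[OF that] by (meson bdd_above_mono image_mono)
  have primal': "primal_value I d C Y' = total_cost I C x"
    using x opt sched by (intro primal_value_eq_optimal_cost) auto
  have primal: "primal_value I d C Y = total_cost I C x"
    using x opt sched by (intro primal_value_eq_optimal_cost) auto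
  have weak': "p * d - (\<Sum>i\<in>I. unit_profit (C i) (Y' i) p) \<le> total_cost I C x" for p
    using weak_duality[OF x bdd'] .
  have "dual_value I d C Y' \<le> total_cost I C x"
    unfolding dual_value_def by (rule cSUP_least) (use weak' in auto)
  then show "0 \<le> primal_value I d C Y' - dual_value I d C Y'"
    by (simp add: primal')
  have profit: "unit_profit (C i) (Y' i) p \<le> unit_profit (C i) (Y i) p" if "i \<in> I" for i p
    unfolding unit_profit_def
    using that x sub bdd by (intro cSUP_subset_mono) (auto simp: schedules_def)
  have "dual_value I d C Y \<le> dual_value I d C Y'"
    unfolding dual_value_def
  proof (rule cSUP_mono)
    show "bdd_above (range (\<lambda>p. p * d - (\<Sum>i\<in>I. unit_profit (C i) (Y' i) p)))"
      using weak' by (intro bdd_aboveI2)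
    show "\<exists>q\<in>UNIV. p * d - (\<Sum>i\<in>I. unit_profit (C i) (Y i) p)
            \<le> q * d - (\<Sum>i\<in>I. unit_profit (C i) (Y' i) q)" for p
      using sum_mono[of I "\<lambda>i. unit_profit (C i) (Y' i) p" "\<lambda>i. unit_profit (C i) (Y i) p"] profit
      by (intro bexI[of _ p]) auto
  qed auto
  then show "primal_value I d C Y' - dual_value I d C Y'
           \<le> primal_value I d C Y - dual_value I d C Y"
    by (simp add: primal primal')
qed

section \<open>Existence of optimal schedules\<close>

lemma compact_PiE:
  fixes Y :: "'i \<Rightarrow> 'a::topological_space set"
  assumes "\<And>i. i \<in> I \<Longrightarrow> compact (Y i)"
  shows "compact (Pi\<^sub>E I Y)"
proof -
  \<comment> \<open>The topology on functions is the product over the whole index type, so the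
      extensional coordinates outside \<open>I\<close> contribute singleton factors.\<close>
  have "Pi\<^sub>E I Y = Pi\<^sub>E UNIV (\<lambda>i. if i \<in> I then Y i else {undefined})"
    by (rule set_eqI) (simp add: PiE_iff extensional_def, blast)
  moreover have "compactin (product_topology (\<lambda>i. euclidean) UNIV)
      (Pi\<^sub>E UNIV (\<lambda>i. if i \<in> I then Y i else {undefined}))"
    using assms by (auto simp: compactin_PiE)
  ultimately show ?thesis
    by (simp add: euclidean_product_topology)
qed

lemma optimal_schedule_exists:
  assumes cpt: "\<And>i. i \<in> I \<Longrightarrow> compact (Y i)"
    and cont: "\<And>i. i \<in> I \<Longrightarrow> continuous_on (Y i) (C i)"
    and ne: "schedules I d Y \<noteq> {}"
  obtains x where "x \<in> schedules I d Y"
    and "\<And>y. y \<in> schedules I d Y \<Longrightarrow> total_cost I C x \<le> total_cost I C y"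
proof -
  have coord: "continuous_on A (\<lambda>x. x i)" for i and A :: "('a \<Rightarrow> real \<times> real) set"
    by (rule continuous_on_subset[OF continuous_on_product_coordinates subset_UNIV])
  have "continuous_on UNIV (\<lambda>x :: 'a \<Rightarrow> real \<times> real. \<Sum>i\<in>I. snd (x i))"
    by (rule continuous_on_sum, rule continuous_on_snd, rule coord)
  then have "closed ((\<lambda>x :: 'a \<Rightarrow> real \<times> real. \<Sum>i\<in>I. snd (x i)) -` {d})"
    by (rule closed_vimage[OF closed_singleton])
  then have "compact (Pi\<^sub>E I Y \<inter> (\<lambda>x. \<Sum>i\<in>I. snd (x i)) -` {d})"
    using cpt by (intro compact_Int_closed compact_PiE)
  moreover have "Pi\<^sub>E I Y \<inter> (\<lambda>x. \<Sum>i\<in>I. snd (x i)) -` {d} = schedules I d Y"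
    by (auto simp: schedules_def)
  ultimately have "compact (schedules I d Y)"
    by simp
  moreover have "continuous_on (schedules I d Y) (total_cost I C)"
    unfolding total_cost_def
    by (rule continuous_on_sum, rule continuous_on_compose2[OF cont coord])
       (auto simp: schedules_def)
  ultimately show ?thesis
    using continuous_attains_inf[OF _ ne] that by blast
qed

section \<open>The unit commitment problem\<close>

lemma unit_feasible_eq: "0 \<le> gmax \<Longrightarrow> unit_feasible gmax = {(0, 0)} \<union> {1} \<times> {0..gmax}"
  by (auto simp: unit_feasible_def)

lemma compact_unit_feasible: "0 \<le> gmax \<Longrightarrow> compact (unit_feasible gmax)"
  by (simp add: unit_feasible_eq compact_Un compact_Times)

lemma continuous_on_unit_cost:
  assumes "0 \<le> gmax" "continuous_on {0..gmax} c"
  shows "continuous_on (unit_feasible gmax) (unit_cost c w)"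
  unfolding unit_cost_def case_prod_beta
  by (intro continuous_intros continuous_on_compose2[OF assms(2)])
     (use assms(1) in \<open>auto simp: unit_feasible_eq\<close>)

text \<open>Committing every unit at the same fraction of its capacity meets the demand.\<close>

lemma schedules_unit_feasible_nonempty:
  assumes pos: "\<And>i. i \<in> I \<Longrightarrow> 0 \<le> gmax i"
    and cap: "0 < (\<Sum>i\<in>I. gmax i)"
    and d: "0 \<le> d" "d \<le> (\<Sum>i\<in>I. gmax i)"
  shows "schedules I d (\<lambda>i. unit_feasible (gmax i)) \<noteq> {}"
proof -
  define t where "t = d / (\<Sum>i\<in>I. gmax i)"
  have t: "0 \<le> t" "t \<le> 1" using cap d by (auto simp: t_def)
  have "(\<Sum>i\<in>I. t * gmax i) = d"
    unfolding sum_distrib_left[symmetric] using cap by (simp add: t_def)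
  then have "(\<lambda>i\<in>I. (1, t * gmax i)) \<in> schedules I d (\<lambda>i. unit_feasible (gmax i))"
    using t pos by (auto simp: schedules_def unit_feasible_def mult_left_le_one_le)
  then show ?thesis by blast
qed

lemma modified_feasible_subset:
  "0 \<le> gmax i \<Longrightarrow> modified_feasible I d gmax C i e \<subseteq> unit_feasible (gmax i)"
  by (auto simp: modified_feasible_def unit_feasible_def)

text \<open>
  The comparison set in the definition of attainability is a subset of all
  feasible schedules, so a global minimizer is minimal there too; the component-wise
  bounds are met by the schedule itself.
\<close>

lemma optimal_schedule_attainable:
  assumes pos: "\<And>i. i \<in> I \<Longrightarrow> 0 \<le> gmax i"
    and x: "x \<in> schedules I d (\<lambda>i. unit_feasible (gmax i))"
    and opt: "\<And>y. y \<in> schedules I d (\<lambda>i. unit_feasible (gmax i))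
                \<Longrightarrow> total_cost I C x \<le> total_cost I C y"
  shows "x \<in> attainable_schedules I d gmax C"
proof -
  have "x i \<in> {0, 1} \<times> {0..gmax i}" if "i \<in> I" for i
  proof -
    have "x i \<in> unit_feasible (gmax i)" using x that by (auto simp: schedules_def)
    then show ?thesis using pos[OF that] by (auto simp: unit_feasible_eq)
  qed
  then have "x \<in> (\<Pi>\<^sub>E i\<in>I. {0, 1} \<times> {0..gmax i})"
    using x by (simp add: schedules_def PiE_iff)
  then show ?thesis
    using x opt by (auto simp: attainable_schedules_def is_arg_min_linorder)
qed

lemma optimal_schedule_modified_feasible:
  assumes pos: "\<And>i. i \<in> I \<Longrightarrow> 0 \<le> gmax i"
    and e: "\<And>i. i \<in> I \<Longrightarrow> 0 \<le> e i"
    and x: "x \<in> schedules I d (\<lambda>i. unit_feasible (gmax i))"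
    and opt: "\<And>y. y \<in> schedules I d (\<lambda>i. unit_feasible (gmax i))
                \<Longrightarrow> total_cost I C x \<le> total_cost I C y"
  shows "x \<in> schedules I d (\<lambda>i. modified_feasible I d gmax C i (e i))"
proof -
  have att: "x \<in> attainable_schedules I d gmax C"
    using pos x opt by (rule optimal_schedule_attainable)
  have "x i \<in> modified_feasible I d gmax C i (e i)" if "i \<in> I" for i
  proof -
    have "x i \<in> unit_feasible (gmax i)" using x that by (auto simp: schedules_def)
    then show ?thesis
      unfolding modified_feasible_def using e[OF that]
      by (intro UnI2 UN_I[OF imageI[OF att]]) (auto simp: case_prod_beta)
  qed
  then show ?thesis using x by (simp add: schedules_def PiE_iff)
qed

theorem mainTheorem4:
  fixes I :: "'i set"
    and gmax w \<epsilon> :: "'i \<Rightarrow> real"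
    and c :: "'i \<Rightarrow> real \<Rightarrow> real"
    and d :: real
  defines "C \<equiv> (\<lambda>i. unit_cost (c i) (w i))"
    and "X \<equiv> (\<lambda>i. unit_feasible (gmax i))"
  assumes "finite I" and "I \<noteq> {}"
    and "\<And>i. i \<in> I \<Longrightarrow> 0 < gmax i"
    and "\<And>i. i \<in> I \<Longrightarrow> 0 \<le> w i"
    and "\<And>i. i \<in> I \<Longrightarrow> mono_on {0..gmax i} (c i)"
    and "\<And>i. i \<in> I \<Longrightarrow> convex_on {0..gmax i} (c i)"
    and "\<And>i. i \<in> I \<Longrightarrow> continuous_on {0..gmax i} (c i)"
    and "\<And>i. i \<in> I \<Longrightarrow> c i 0 = 0"
    and "0 \<le> d" and "d \<le> (\<Sum>i\<in>I. gmax i)"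
    and "\<And>i. i \<in> I \<Longrightarrow> 0 < \<epsilon> i"
  defines "X' \<equiv> (\<lambda>i. modified_feasible I d gmax C i (\<epsilon> i))"
  shows "0 \<le> primal_value I d C X' - dual_value I d C X' \<and>
         primal_value I d C X' - dual_value I d C X'
           \<le> primal_value I d C X - dual_value I d C X"
proof -
  have g: "\<And>i. i \<in> I \<Longrightarrow> 0 \<le> gmax i" using assms(5) by (simp add: less_imp_le)
  have e: "\<And>i. i \<in> I \<Longrightarrow> 0 \<le> \<epsilon> i" using assms(13) by (simp add: less_imp_le)
  have cpt: "compact (X i)" if "i \<in> I" for i
    unfolding X_def using g[OF that] by (rule compact_unit_feasible)
  have cont: "continuous_on (X i) (C i)" if "i \<in> I" for i
    unfolding X_def C_def using g[OF that] assms(9)[OF that] by (rule continuous_on_unit_cost)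
  have "0 < (\<Sum>i\<in>I. gmax i)"
    using assms(3-5) by (intro sum_pos)
  then have "schedules I d X \<noteq> {}"
    unfolding X_def using g assms(11,12) by (intro schedules_unit_feasible_nonempty)
  then obtain x where x: "x \<in> schedules I d X"
    and opt: "\<And>y. y \<in> schedules I d X \<Longrightarrow> total_cost I C x \<le> total_cost I C y"
    using optimal_schedule_exists[of I X C d] cpt cont by blast
  have x': "x \<in> schedules I d X'"
    unfolding X'_def using g e x opt unfolding X_def
    by (rule optimal_schedule_modified_feasible)
  have sub: "X' i \<subseteq> X i" if "i \<in> I" for i
    unfolding X'_def X_def using g[OF that] by (rule modified_feasible_subset)
  have bdd: "bdd_above ((\<lambda>y. p * snd y - C i y) ` X i)" if "i \<in> I" for i p
    by (intro bounded_imp_bdd_above compact_imp_bounded compact_continuous_image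
        continuous_intros cont cpt that)
  show ?thesis
    using duality_gap_mono[of I X' X C x d, OF sub bdd x' opt] by blast
qed

end
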